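(* Let $r\ge1$, let $\alpha_1,\dots,\alpha_r\in\mathbb C$ be pairwise distinct and let $w_1,\dots,w_r\in\mathbb C\setminus\{0\}$ (independent of $q$). Then, as $q\to1$ through positive real values, $$\det H_{r,0}^{(q)}=\left(\prod_{\ell=1}^{r}w_\ell\right)(\log q)^{r(r-1)}\prod_{1\le k<\ell\le r}(\alpha_\ell-\alpha_k)^2\,\bigl(1+O(|\log q|)\bigr).$$
   Context: For $q>0$, $\rho_\ell(q)=q^{\alpha_\ell}=e^{\alpha_\ell\log q}$, $\mu_n^{(q)}=\sum_{\ell=1}^r w_\ell\rho_\ell(q)^n$ for $n\ge0$, and $H_{r,0}^{(q)}=(\mu_{i+j}^{(q)})_{i,j=0}^{r-1}$. *)

theory Defs
  imports Complex_Main "HOL-Library.Landau_Symbols" "Jordan_Normal_Form.Determinant"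
begin

text \<open>
  Families \<open>\<alpha>\<^sub>1, \<dots>, \<alpha>\<^sub>r\<close> and \<open>w\<^sub>1, \<dots>, w\<^sub>r\<close> are functions on \<^typ>\<open>nat\<close> of which only the
  values on \<open>{1..r}\<close> matter; matrix rows and columns are indexed by \<open>0, \<dots>, r - 1\<close>.
\<close>

definition rho :: "(nat \<Rightarrow> complex) \<Rightarrow> real \<Rightarrow> nat \<Rightarrow> complex" where
  "rho \<alpha> q l = exp (\<alpha> l * complex_of_real (ln q))"

definition mu :: "nat \<Rightarrow> (nat \<Rightarrow> complex) \<Rightarrow> (nat \<Rightarrow> complex) \<Rightarrow> real \<Rightarrow> nat \<Rightarrow> complex" where
  "mu r \<alpha> w q n = (\<Sum>l = 1..r. w l * rho \<alpha> q l ^ n)"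

definition hankel0 :: "nat \<Rightarrow> (nat \<Rightarrow> complex) \<Rightarrow> (nat \<Rightarrow> complex) \<Rightarrow> real \<Rightarrow> complex mat" where
  "hankel0 r \<alpha> w q = mat r r (\<lambda>(i, j). mu r \<alpha> w q (i + j))"

end

theory Submission
  imports Defs "HOL-Analysis.Complex_Transcendental"
begin

text \<open>
  The Hankel matrix of the moments \<open>\<mu>\<^sub>n = \<Sum>\<^sub>l w\<^sub>l \<rho>\<^sub>l\<^sup>n\<close> is \<open>V D V\<^sup>T\<close>, where \<open>V\<close> is the Vandermonde matrix
  of the nodes \<open>\<rho>\<^sub>l\<close> and \<open>D\<close> is the diagonal matrix of the weights. Its determinant is therefore
  exactly the product of the weights times the squared Vandermonde product
  (\<open>det_hankel_moments\<close>), for every \<open>q\<close>.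

  With \<open>t = ln q\<close>, each node difference is
  \<open>exp (\<alpha>\<^sub>l t) - exp (\<alpha>\<^sub>k t) = (\<alpha>\<^sub>l - \<alpha>\<^sub>k) t (1 + O(t))\<close> because the quadratic Taylor remainder of the
  exponential is \<open>O(t\<^sup>2)\<close> and \<open>\<alpha>\<^sub>l \<noteq> \<alpha>\<^sub>k\<close> (\<open>exp_diff_quotient_bigo\<close>). There are \<open>r (r - 1) / 2\<close> pairs,
  each occurring squared, which accounts for the power of \<open>ln q\<close>; the finitely many factors
  \<open>1 + O(t)\<close> multiply to a single one (\<open>prod_minus_one_bigo\<close>).
\<close>

section \<open>The Hankel determinant of a finite moment sequence\<close>

text \<open>
  The Newton polynomials \<open>\<Prod>\<^sub>j\<^sub><\<^sub>i (X - x\<^sub>j)\<close> are monic of degree \<open>i\<close>, so their coefficients form a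
  unit lower triangular matrix. Multiplying the Vandermonde matrix by it replaces the row of
  powers \<open>x\<^sub>l\<^sup>i\<close> by the values of the \<open>i\<close>-th Newton polynomial, which vanish for \<open>l < i\<close>; the
  determinant can then be read off the diagonal.
\<close>

lemma det_vandermonde:
  fixes x :: "nat \<Rightarrow> 'a :: idom"
  shows "Determinant.det (Matrix.mat n n (\<lambda>(i, l). x l ^ i)) = (\<Prod>i<n. \<Prod>j<i. x i - x j)"
proof -
  define p where "p i = (\<Prod>j<i. [:- x j, 1:])" for i
  have deg: "degree (p i) = i" for i
    unfolding p_def by (subst degree_prod_eq_sum_degree) auto
  have lead: "coeff (p i) i = 1" for i
    using lead_coeff_prod[of "\<lambda>j. [:- x j, 1:]" "{..<i}"] deg[of i] by (simp add: p_def)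
  have eval: "poly (p i) y = (\<Prod>j<i. y - x j)" for i y
    by (simp add: p_def poly_prod)
  define V where "V = Matrix.mat n n (\<lambda>(i, l). x l ^ i)"
  define L where "L = Matrix.mat n n (\<lambda>(i, j). coeff (p i) j)"
  define U where "U = Matrix.mat n n (\<lambda>(i, l). poly (p i) (x l))"
  have carrier: "V \<in> carrier_mat n n" "L \<in> carrier_mat n n" "U \<in> carrier_mat n n"
    by (simp_all add: V_def L_def U_def)
  have "L * V = U"
  proof (rule eq_matI)
    fix i l assume "i < dim_row U" "l < dim_col U"
    then have il: "i < n" "l < n" by (simp_all add: U_def)
    have "(L * V) $$ (i, l) = (\<Sum>j<n. coeff (p i) j * x l ^ j)"
      using il by (simp add: L_def V_def scalar_prod_def atLeast0LessThan)
    also have "\<dots> = (\<Sum>j\<le>i. coeff (p i) j * x l ^ j)"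
      using il by (intro sum.mono_neutral_right) (auto simp: coeff_eq_0 deg)
    also have "\<dots> = U $$ (i, l)"
      using il by (simp add: U_def poly_altdef deg)
    finally show "(L * V) $$ (i, l) = U $$ (i, l)" .
  qed (simp_all add: L_def U_def V_def)
  then have "Determinant.det L * Determinant.det V = Determinant.det U"
    using det_mult[OF carrier(2,1)] by simp
  moreover have "Determinant.det L = 1"
  proof -
    have "Determinant.det L = prod_list (diag_mat L)"
      by (rule det_lower_triangular[OF _ carrier(2)]) (simp add: L_def coeff_eq_0 deg)
    also have "\<dots> = 1"
      by (simp add: prod_list_diag_prod L_def lead)
    finally show ?thesis .
  qed
  moreover have "Determinant.det U = (\<Prod>i<n. \<Prod>j<i. x i - x j)"
  proof -
    have "Determinant.det U = prod_list (diag_mat U)"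
      by (rule det_upper_triangular[OF _ carrier(3)], rule upper_triangularI)
        (auto simp: U_def eval)
    also have "\<dots> = (\<Prod>i<n. \<Prod>j<i. x i - x j)"
      by (simp add: prod_list_diag_prod U_def eval atLeast0LessThan)
    finally show ?thesis .
  qed
  ultimately show ?thesis by (simp add: V_def)
qed

text \<open>
  The sum over the nodes is a matrix product: the matrix factors as \<open>V D V\<^sup>T\<close>.
\<close>

lemma det_hankel_moments:
  fixes x w :: "nat \<Rightarrow> 'a :: idom"
  shows "Determinant.det (Matrix.mat n n (\<lambda>(i, j). \<Sum>l<n. w l * x l ^ (i + j))) =
    (\<Prod>l<n. w l) * (\<Prod>i<n. \<Prod>j<i. x i - x j)\<^sup>2"
proof -
  define V where "V = Matrix.mat n n (\<lambda>(i, l). x l ^ i)"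
  define D where "D = Matrix.mat n n (\<lambda>(i, j). if i = j then w i else 0)"
  have carrier: "V \<in> carrier_mat n n" "D \<in> carrier_mat n n" "V\<^sup>T \<in> carrier_mat n n"
    by (simp_all add: V_def D_def)
  have VD: "V * D = Matrix.mat n n (\<lambda>(i, l). w l * x l ^ i)"
    by (rule eq_matI) (auto simp: V_def D_def scalar_prod_def if_distrib mult.commute cong: if_cong)
  have "Matrix.mat n n (\<lambda>(i, j). \<Sum>l<n. w l * x l ^ (i + j)) = V * D * V\<^sup>T"
    unfolding VD by (rule eq_matI)
      (auto simp: V_def scalar_prod_def power_add mult.assoc atLeast0LessThan)
  moreover have "Determinant.det (V * D * V\<^sup>T) =
      Determinant.det V * Determinant.det D * Determinant.det V"
    using carrier by (simp add: det_mult[of _ n] det_transpose)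
  moreover have "Determinant.det D = (\<Prod>l<n. w l)"
  proof -
    have "Determinant.det D = prod_list (diag_mat D)"
      by (rule det_upper_triangular[OF _ carrier(2)], rule upper_triangularI) (auto simp: D_def)
    then show ?thesis by (simp add: prod_list_diag_prod D_def atLeast0LessThan)
  qed
  ultimately show ?thesis
    using det_vandermonde[of n x] by (simp add: V_def power2_eq_square mult_ac)
qed

section \<open>Products over ordered pairs of indices\<close>

lemma prod_pairs_eq:
  fixes f :: "nat \<Rightarrow> nat \<Rightarrow> 'a :: comm_monoid_mult"
  shows "(\<Prod>(k, l)\<in>{(k, l). 1 \<le> k \<and> k < l \<and> l \<le> r}. f k l) =
    (\<Prod>i<r. \<Prod>j<i. f (Suc j) (Suc i))"
proof -
  have "(\<Prod>i<r. \<Prod>j<i. f (Suc j) (Suc i)) =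
      (\<Prod>(i, j)\<in>(SIGMA i:{..<r}. {..<i}). f (Suc j) (Suc i))"
    by (rule prod.Sigma) auto
  also have "\<dots> = (\<Prod>(k, l)\<in>{(k, l). 1 \<le> k \<and> k < l \<and> l \<le> r}. f k l)"
    by (rule prod.reindex_bij_witness[of _ "\<lambda>(k, l). (l - 1, k - 1)" "\<lambda>(i, j). (Suc j, Suc i)"]) auto
  finally show ?thesis by simp
qed

lemma finite_pairs: "finite {(k, l). 1 \<le> k \<and> k < l \<and> l \<le> (r :: nat)}"
  by (rule finite_subset[of _ "{..r} \<times> {..r}"]) auto

lemma prod_pairs_const_square:
  fixes t :: "'a :: comm_monoid_mult"
  shows "(\<Prod>(k, l)\<in>{(k, l). 1 \<le> k \<and> k < l \<and> l \<le> r}. t)\<^sup>2 = t ^ (r * (r - 1))"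
proof -
  have "(\<Prod>i<r. \<Prod>j<i. t) ^ 2 = t ^ (r * (r - 1))"
  proof (induction r)
    case (Suc r)
    have "(\<Prod>i<Suc r. \<Prod>j<i. t)\<^sup>2 = t ^ (r * (r - 1) + 2 * r)"
      using Suc by (simp add: power_mult_distrib power_add power_mult[symmetric] mult_ac)
    also have "r * (r - 1) + 2 * r = Suc r * (Suc r - 1)" by (cases r) auto
    finally show ?case .
  qed simp
  then show ?thesis using prod_pairs_eq[of "\<lambda>_ _. t" r] by simp
qed

lemma det_hankel0:
  "Determinant.det (hankel0 r \<alpha> w q) = (\<Prod>l = 1..r. w l) *
    (\<Prod>(k, l)\<in>{(k, l). 1 \<le> k \<and> k < l \<and> l \<le> r}. rho \<alpha> q l - rho \<alpha> q k)\<^sup>2"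
proof -
  have shift: "{1..r} = Suc ` {..<r}"
    by (simp add: image_Suc_lessThan)
  have "hankel0 r \<alpha> w q = Matrix.mat r r (\<lambda>(i, j). \<Sum>l<r. w (Suc l) * rho \<alpha> q (Suc l) ^ (i + j))"
    unfolding hankel0_def mu_def shift by (simp add: sum.reindex)
  moreover have "(\<Prod>l = 1..r. w l) = (\<Prod>l<r. w (Suc l))"
    unfolding shift by (simp add: prod.reindex)
  ultimately show ?thesis
    using det_hankel_moments[of r "\<lambda>l. w (Suc l)" "\<lambda>l. rho \<alpha> q (Suc l)"]
    unfolding prod_pairs_eq[of "\<lambda>k l. rho \<alpha> q l - rho \<alpha> q k"] by simp
qed

section \<open>First-order asymptotics\<close>

lemma exp_remainder_bigo:
  fixes a :: complex
  shows "(\<lambda>z. exp (a * z) - 1 - a * z) \<in> O[at 0](\<lambda>z. z ^ 2)"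
proof (rule bigoI)
  have "\<forall>\<^sub>F z in at 0. norm (z :: complex) < 1"
    using eventually_at_ball[of 1 "0 :: complex" UNIV] by simp
  then show "\<forall>\<^sub>F z in at 0. norm (exp (a * z) - 1 - a * z) \<le>
      (exp (norm a) * norm a ^ 2) * norm (z ^ 2)"
  proof eventually_elim
    case (elim z)
    have "norm (exp (a * z) - 1 - a * z) \<le> exp \<bar>Re (a * z)\<bar> * norm (a * z) ^ 2"
      using Taylor_exp[of "a * z" 1] by (simp add: algebra_simps power2_eq_square)
    also have "\<bar>Re (a * z)\<bar> \<le> norm a"
      using elim abs_Re_le_cmod[of "a * z"] mult_left_mono[of "norm z" 1 "norm a"]
      by (simp add: norm_mult)
    then have "exp \<bar>Re (a * z)\<bar> * norm (a * z) ^ 2 \<le> exp (norm a) * norm (a * z) ^ 2"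
      by (intro mult_right_mono) auto
    finally show ?case by (simp add: norm_mult norm_power power_mult_distrib mult_ac)
  qed
qed

text \<open>
  The quotient minus one is the difference of the quadratic remainders for \<open>a\<close> and \<open>b\<close> divided
  by \<open>(a - b) z\<close>, which costs one of the two powers of \<open>z\<close>.
\<close>

lemma exp_diff_quotient_bigo:
  fixes a b :: complex
  assumes "a \<noteq> b"
  shows "(\<lambda>z. (exp (a * z) - exp (b * z)) / ((a - b) * z) - 1) \<in> O[at 0](\<lambda>z. z)"
proof -
  have quotient: "((exp (a * z) - 1 - a * z) - (exp (b * z) - 1 - b * z)) * (1 / ((a - b) * z)) =
      (exp (a * z) - exp (b * z)) / ((a - b) * z) - 1" if "z \<noteq> 0" for z
  proof -
    have linear: "(exp (a * z) - 1 - a * z) - (exp (b * z) - 1 - b * z) =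
        (exp (a * z) - exp (b * z)) - (a - b) * z"
      by (simp add: algebra_simps)
    show ?thesis
      unfolding linear using assms that by (simp add: diff_divide_distrib)
  qed
  have "(\<lambda>z. (exp (a * z) - 1 - a * z) - (exp (b * z) - 1 - b * z)) \<in> O[at 0](\<lambda>z. z ^ 2)"
    by (intro sum_in_bigo exp_remainder_bigo)
  then have "(\<lambda>z. ((exp (a * z) - 1 - a * z) - (exp (b * z) - 1 - b * z)) * (1 / ((a - b) * z)))
      \<in> O[at 0](\<lambda>z. z ^ 2 * (1 / ((a - b) * z)))"
    by (rule landau_o.big.mult_right)
  also have "?this \<longleftrightarrow> (\<lambda>z. (exp (a * z) - exp (b * z)) / ((a - b) * z) - 1)
      \<in> O[at 0](\<lambda>z. (1 / (a - b)) * z)"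
  proof (rule landau_o.big.cong_ex)
    show "\<forall>\<^sub>F z in at 0. ((exp (a * z) - 1 - a * z) - (exp (b * z) - 1 - b * z)) *
        (1 / ((a - b) * z)) = (exp (a * z) - exp (b * z)) / ((a - b) * z) - 1"
      unfolding eventually_at_filter by (rule always_eventually) (use quotient in blast)
    show "\<forall>\<^sub>F z in at 0. z ^ 2 * (1 / ((a - b) * z)) = (1 / (a - b)) * z"
      by (auto simp: eventually_at_filter power2_eq_square)
  qed
  also have "\<dots> \<longleftrightarrow> (\<lambda>z. (exp (a * z) - exp (b * z)) / ((a - b) * z) - 1) \<in> O[at 0](\<lambda>z. z)"
    using assms by (subst landau_o.big.cmult) auto
  finally show ?thesis .
qed

text \<open>
  In the expansion \<open>u v - 1 = (u - 1) + (v - 1) + (u - 1) (v - 1)\<close> the last term is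
  \<open>O(g\<^sup>2)\<close>, which boundedness of \<open>g\<close> turns into \<open>O(g)\<close>.
\<close>

lemma mult_minus_one_bigo:
  fixes u v g :: "'a \<Rightarrow> complex"
  assumes "(\<lambda>x. u x - 1) \<in> O[F](g)" "(\<lambda>x. v x - 1) \<in> O[F](g)" "g \<in> O[F](\<lambda>_. 1)"
  shows "(\<lambda>x. u x * v x - 1) \<in> O[F](g)"
proof -
  have "(\<lambda>x. (u x - 1) * (v x - 1)) \<in> O[F](\<lambda>x. g x * 1)"
    by (rule landau_o.big.mult[OF assms(1) landau_o.big_trans[OF assms(2,3)]])
  then have "(\<lambda>x. (u x - 1) + (v x - 1) + (u x - 1) * (v x - 1)) \<in> O[F](g)"
    by (intro sum_in_bigo(1) assms(1,2)) simp
  then show ?thesis by (simp add: algebra_simps)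
qed

lemma prod_minus_one_bigo:
  fixes f :: "'i \<Rightarrow> 'a \<Rightarrow> complex"
  assumes "finite A" "\<And>i. i \<in> A \<Longrightarrow> (\<lambda>x. f i x - 1) \<in> O[F](g)" "g \<in> O[F](\<lambda>_. 1)"
  shows "(\<lambda>x. (\<Prod>i\<in>A. f i x) - 1) \<in> O[F](g)"
  using assms(1,2)
  by (induction A rule: finite_induct) (auto intro!: mult_minus_one_bigo assms(3))

lemma filterlim_ln_at_1:
  "filterlim (\<lambda>q. complex_of_real (ln q)) (at 0) (at 1 within {0<..})"
proof (rule filterlim_atI)
  have "((\<lambda>q. complex_of_real (ln q)) \<longlongrightarrow> complex_of_real (ln 1)) (at 1 within {0<..})"
    by (intro tendsto_intros) auto
  then show "((\<lambda>q. complex_of_real (ln q)) \<longlongrightarrow> 0) (at 1 within {0<..})" by simp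
  show "\<forall>\<^sub>F q in at 1 within {0<..}. complex_of_real (ln q) \<noteq> 0"
    by (auto simp: eventually_at_filter)
qed

section \<open>The determinant near \<open>q = 1\<close>\<close>

theorem corollary4p1:
  fixes r :: nat and \<alpha> w :: "nat \<Rightarrow> complex"
  assumes "r \<ge> 1"
    and "inj_on \<alpha> {1..r}"
    and "\<forall>l\<in>{1..r}. w l \<noteq> 0"
  shows "\<exists>E :: real \<Rightarrow> complex.
    E \<in> O[at 1 within {0<..}](\<lambda>q. complex_of_real \<bar>ln q\<bar>) \<and>
    (\<forall>\<^sub>F q in at 1 within {0<..}.
      Determinant.det (hankel0 r \<alpha> w q) =
        (\<Prod>l = 1..r. w l) * complex_of_real (ln q) ^ (r * (r - 1)) *
        (\<Prod>(k, l)\<in>{(k, l). 1 \<le> k \<and> k < l \<and> l \<le> r}. (\<alpha> l - \<alpha> k)\<^sup>2) * (1 + E q))"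
proof -
  define P where "P = {(k, l). 1 \<le> k \<and> k < l \<and> l \<le> r}"
  define F where "F = at (1 :: real) within {0<..}"
  define t where "t q = complex_of_real (ln q)" for q
  define \<phi> where "\<phi> p z =
    (exp (\<alpha> (snd p) * z) - exp (\<alpha> (fst p) * z)) / ((\<alpha> (snd p) - \<alpha> (fst p)) * z)" for p z
  define R where "R q = (\<Prod>p\<in>P. \<phi> p (t q))" for q
  have distinct: "\<alpha> (snd p) \<noteq> \<alpha> (fst p)" if "p \<in> P" for p
    using that assms(2) by (auto simp: P_def dest!: inj_onD)
  have t_lim: "filterlim t (at 0) F"
    unfolding t_def F_def by (rule filterlim_ln_at_1)
  have "(t \<longlongrightarrow> 0) F"
    using t_lim by (simp add: filterlim_at)
  then have t_bounded: "t \<in> O[F](\<lambda>_. 1)"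
    by (intro bigoI_tendsto[of _ _ 0]) auto
  have "(\<lambda>q. \<phi> p (t q) - 1) \<in> O[F](t)" if "p \<in> P" for p
    using landau_o.big.compose[OF exp_diff_quotient_bigo[OF distinct[OF that]] t_lim]
    by (simp add: \<phi>_def)
  then have R: "(\<lambda>q. R q - 1) \<in> O[F](t)"
    unfolding R_def using t_bounded finite_pairs[of r]
    by (intro prod_minus_one_bigo) (auto simp: P_def)
  have "(\<lambda>q. R q ^ 2 - 1) \<in> O[F](t)"
    unfolding power2_eq_square by (intro mult_minus_one_bigo R t_bounded)
  moreover have "t \<in> O[F](\<lambda>q. complex_of_real \<bar>ln q\<bar>)"
    by (rule bigoI[of _ 1]) (simp add: t_def)
  ultimately have error: "(\<lambda>q. R q ^ 2 - 1) \<in> O[F](\<lambda>q. complex_of_real \<bar>ln q\<bar>)"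
    by (rule landau_o.big_trans)
  have "\<forall>\<^sub>F q in F. t q \<noteq> 0"
    using t_lim by (simp add: filterlim_at)
  then have "\<forall>\<^sub>F q in F. Determinant.det (hankel0 r \<alpha> w q) =
      (\<Prod>l = 1..r. w l) * t q ^ (r * (r - 1)) *
      (\<Prod>(k, l)\<in>P. (\<alpha> l - \<alpha> k)\<^sup>2) * (1 + (R q ^ 2 - 1))"
  proof eventually_elim
    case (elim q)
    have "(\<Prod>(k, l)\<in>P. rho \<alpha> q l - rho \<alpha> q k) =
        (\<Prod>p\<in>P. t q * (\<alpha> (snd p) - \<alpha> (fst p)) * \<phi> p (t q))"
      using elim distinct by (intro prod.cong) (auto simp: rho_def \<phi>_def t_def)
    also have "\<dots> = (\<Prod>(k, l)\<in>P. t q) * (\<Prod>(k, l)\<in>P. \<alpha> l - \<alpha> k) * R q"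
      by (simp add: prod.distrib R_def case_prod_unfold)
    finally have "(\<Prod>(k, l)\<in>P. rho \<alpha> q l - rho \<alpha> q k)\<^sup>2 =
        (\<Prod>(k, l)\<in>P. t q)\<^sup>2 * (\<Prod>(k, l)\<in>P. \<alpha> l - \<alpha> k)\<^sup>2 * R q ^ 2"
      by (simp add: power_mult_distrib)
    also have "(\<Prod>(k, l)\<in>P. t q)\<^sup>2 = t q ^ (r * (r - 1))"
      unfolding P_def by (rule prod_pairs_const_square)
    also have "(\<Prod>(k, l)\<in>P. \<alpha> l - \<alpha> k)\<^sup>2 = (\<Prod>(k, l)\<in>P. (\<alpha> l - \<alpha> k)\<^sup>2)"
      by (simp add: prod_power_distrib case_prod_unfold)
    finally show ?case
      unfolding det_hankel0 P_def[symmetric] by (simp add: mult_ac)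
  qed
  with error show ?thesis
    unfolding F_def P_def t_def by (intro exI[of _ "\<lambda>q. R q ^ 2 - 1"]) blast
qed

end
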